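(* Let $n,m\ge 0$ be integers with $2n+m\ge 1$ and $(n,m)\neq(0,1)$. Let $G$ be a simple graph with $\chi_{n,m}(G)=k$. Then $$\mathrm{arb}(G)\le \left\lceil \log_{2n+m} k+\frac{k}{2}\right\rceil .$$
   Context: All graphs are finite. An $(n,m)$-graph $G$ is a graph with $n$ types of arcs (labeled $2,4,\ldots,2n$) and $m$ types of edges (labeled $2n+1,\ldots,2n+m$), whose underlying undirected graph $\mathrm{und}(G)$ is simple (so each adjacent pair of distinct vertices is joined by exactly one arc or exactly one edge, with exactly one type, and there are no loops). A homomorphism of an $(n,m)$-graph $G$ to an $(n,m)$-graph $H$ is a map $f:V(G)\to V(H)$ such that whenever $uv$ is an arc from $u$ to $v$ (resp. an edge) of type $\alpha$ in $G$, $f(u)f(v)$ is an arc from $f(u)$ to $f(v)$ (resp. an edge) of type $\alpha$ in $H$; write $G\to H$ if one exists. For an $(n,m)$-graph $G$, $\chi_{n,m}(G)=\min\{|V(H)|: H \text{ an } (n,m)\text{-graph},\ G\to H\}$. For a simple graph $S$, $\chi_{n,m}(S)=\max\{\chi_{n,m}(G): G \text{ an } (n,m)\text{-graph with } \mathrm{und}(G)=S\}$. The arboricity $\mathrm{arb}(G)$ of a graph $G$ is the minimum $r$ such that the edge set of $G$ can be decomposed into $r$ forests. *)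

theory Defs
  imports Complex_Main
begin

section \<open>Simple graphs, forests, arboricity\<close>

type_synonym 'a ugraph = "'a set \<times> 'a set set"

definition simple_graph :: "'a ugraph \<Rightarrow> bool" where
  "simple_graph S \<longleftrightarrow> finite (fst S) \<and>
     (\<forall>e\<in>snd S. \<exists>u\<in>fst S. \<exists>v\<in>fst S. u \<noteq> v \<and> e = {u, v})"

text \<open>A cycle is given by its cyclic sequence of at least three distinct vertices.\<close>

definition is_cycle :: "'a set set \<Rightarrow> 'a list \<Rightarrow> bool" where
  "is_cycle F vs \<longleftrightarrow> 3 \<le> length vs \<and> distinct vs \<and>
     (\<forall>i<length vs. {vs ! i, vs ! (Suc i mod length vs)} \<in> F)"

definition forest :: "'a set set \<Rightarrow> bool" where
  "forest F \<longleftrightarrow> (\<nexists>vs. is_cycle F vs)"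

definition forest_decomposition :: "'a ugraph \<Rightarrow> nat \<Rightarrow> (nat \<Rightarrow> 'a set set) \<Rightarrow> bool" where
  "forest_decomposition S r F \<longleftrightarrow> (\<Union>i<r. F i) = snd S \<and>
     (\<forall>i<r. \<forall>j<r. i \<noteq> j \<longrightarrow> F i \<inter> F j = {}) \<and> (\<forall>i<r. forest (F i))"

definition arboricity :: "'a ugraph \<Rightarrow> nat" where
  "arboricity S = (LEAST r. \<exists>F. forest_decomposition S r F)"

section \<open>$(n,m)$-graphs\<close>

definition arc_types :: "nat \<Rightarrow> nat set" where
  "arc_types n = {2 * i | i. 1 \<le> i \<and> i \<le> n}"

definition edge_types :: "nat \<Rightarrow> nat \<Rightarrow> nat set" where
  "edge_types n m = {2 * n + 1 .. 2 * n + m}"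

text \<open>\<open>arcs G a\<close> and \<open>edges G a\<close> are the arcs and the edges of type \<open>a\<close>.\<close>

record 'a nm_graph =
  verts :: "'a set"
  arcs :: "nat \<Rightarrow> ('a \<times> 'a) set"
  edges :: "nat \<Rightarrow> 'a set set"

text \<open>
  The last four assumptions say that two vertices are joined by at most one arc or edge.
  Requiring \<open>arcs\<close> and \<open>edges\<close> to be empty outside the admissible types makes the
  representation canonical: there are finitely many \<open>(n,m)\<close>-graphs on a finite vertex set.
\<close>

locale is_nm_graph =
  fixes n m :: nat and G :: "'a nm_graph"
  assumes finite_verts: "finite (verts G)"
    and arc_type: "(u, v) \<in> arcs G a \<Longrightarrow> a \<in> arc_types n"
    and edge_type: "e \<in> edges G a \<Longrightarrow> a \<in> edge_types n m"
    and arc_ends: "(u, v) \<in> arcs G a \<Longrightarrow> u \<in> verts G \<and> v \<in> verts G \<and> u \<noteq> v"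
    and edge_ends: "e \<in> edges G a \<Longrightarrow> \<exists>u\<in>verts G. \<exists>v\<in>verts G. u \<noteq> v \<and> e = {u, v}"
    and arc_unique: "(u, v) \<in> arcs G a \<Longrightarrow> (u, v) \<in> arcs G b \<Longrightarrow> a = b"
    and edge_unique: "e \<in> edges G a \<Longrightarrow> e \<in> edges G b \<Longrightarrow> a = b"
    and no_opposite_arc: "(u, v) \<in> arcs G a \<Longrightarrow> (v, u) \<notin> arcs G b"
    and no_arc_and_edge: "(u, v) \<in> arcs G a \<Longrightarrow> {u, v} \<notin> edges G b"

definition und :: "'a nm_graph \<Rightarrow> 'a ugraph" where
  "und G = (verts G, {{u, v} | u v. \<exists>a. (u, v) \<in> arcs G a} \<union> (\<Union>a. edges G a))"

definition nm_hom :: "'a nm_graph \<Rightarrow> 'b nm_graph \<Rightarrow> ('a \<Rightarrow> 'b) \<Rightarrow> bool" where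
  "nm_hom G H f \<longleftrightarrow> f ` verts G \<subseteq> verts H \<and>
     (\<forall>a u v. (u, v) \<in> arcs G a \<longrightarrow> (f u, f v) \<in> arcs H a) \<and>
     (\<forall>a u v. {u, v} \<in> edges G a \<longrightarrow> {f u, f v} \<in> edges H a)"

text \<open>
  Every finite graph is isomorphic to one with vertices in \<open>nat\<close>, so it is no restriction
  that the targets \<open>H\<close> range over graphs of that type.
\<close>

definition chi_nm :: "nat \<Rightarrow> nat \<Rightarrow> 'a nm_graph \<Rightarrow> nat" where
  "chi_nm n m G =
     (LEAST k. \<exists>H :: nat nm_graph. is_nm_graph n m H \<and> card (verts H) = k \<and> (\<exists>f. nm_hom G H f))"

definition chi_nm_simple :: "nat \<Rightarrow> nat \<Rightarrow> 'a ugraph \<Rightarrow> nat" where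
  "chi_nm_simple n m S = Max {chi_nm n m G | G. is_nm_graph n m G \<and> und G = S}"

end

theory Submission
  imports Defs "HOL-Library.FuncSet"
begin

text \<open>
  Let \<open>p = 2 * n + m\<close>. By the Nash-Williams theorem it suffices that every set of \<open>N \<ge> 2\<close> vertices
  spans at most \<open>r * (N - 1)\<close> edges, where \<open>r\<close> is the claimed bound. If \<open>q\<close> edges are spanned, they
  can be turned into arcs and edges in \<open>p ^ q\<close> ways; each way is the pullback of one of at most
  \<open>p ^ (k choose 2)\<close> targets along one of \<open>k ^ N\<close> maps, whence \<open>q \<le> N * log p k + (k choose 2)\<close>.
  This suffices for \<open>N > k\<close>, and for \<open>N \<le> k\<close> the trivial bound \<open>q \<le> N choose 2\<close> does.

  The Nash-Williams theorem is obtained from a matroid partition argument. The exchange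
  sequences of an uncovered element are organised by a decreasing chain of levels
  \<open>L (j + 1) = L j \<inter> (\<Inter>i<r. span (I i \<inter> L j))\<close>: an exchange replaces an element outside
  \<open>L (j + 1)\<close> by one outside \<open>L j\<close>, while a stable level violates the density condition.
\<close>


section \<open>Partitioning a matroid into independent sets\<close>

text \<open>A matroid presented by its closure operator; \<open>exchange\<close> is the Mac
  Lane-Steinitz property. Finiteness comes from the sets to which the lemmas are applied.\<close>

locale pregeometry =
  fixes span :: "'e set \<Rightarrow> 'e set"
  assumes extensive: "A \<subseteq> span A"
    and span_mono: "A \<subseteq> B \<Longrightarrow> span A \<subseteq> span B"
    and idem: "span (span A) = span A"
    and exchange: "e \<in> span (insert y A) \<Longrightarrow> e \<notin> span A \<Longrightarrow> y \<in> span (insert e A)"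
begin

definition indep :: "'e set \<Rightarrow> bool" where
  "indep A \<longleftrightarrow> (\<forall>x\<in>A. x \<notin> span (A - {x}))"

lemma span_minimal: "A \<subseteq> span B \<Longrightarrow> span A \<subseteq> span B"
  using span_mono idem by metis

text \<open>If adding \<open>e\<close> made some \<open>x\<close> in \<open>A\<close> dependent,
  exchange would put \<open>e\<close> into the span of \<open>insert x (A - {x})\<close>, which is
  the span of \<open>A\<close>.\<close>

lemma indep_insert:
  assumes "indep A" "e \<notin> span A"
  shows "indep (insert e A)"
  unfolding indep_def
proof
  fix x assume x: "x \<in> insert e A"
  have eA: "e \<notin> A" using assms extensive by blast
  show "x \<notin> span (insert e A - {x})"
  proof (cases "x = e")
    case True
    then show ?thesis using eA assms by simp
  next
    case False
    then have xA: "x \<in> A" using x by simp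
    have eq: "insert e A - {x} = insert e (A - {x})" using False by auto
    have "x \<notin> span (A - {x})" using assms xA by (simp add: indep_def)
    moreover have "insert x (A - {x}) = A" using xA by auto
    ultimately show ?thesis using exchange[of x e "A - {x}"] assms(2) eq by metis
  qed
qed

lemma indep_subset: "indep A \<Longrightarrow> B \<subseteq> A \<Longrightarrow> indep B"
  unfolding indep_def by (meson Diff_mono order_refl span_mono subsetD)

text \<open>An element outside \<open>S\<close> of a minimal subset of \<open>I\<close> spanning \<open>e\<close> can be exchanged.\<close>

lemma exchange_outside:
  assumes "finite I" "indep I" "e \<in> span I" "e \<notin> span (I \<inter> S)"
  obtains y where "y \<in> I" "y \<notin> S" "e \<notin> span (I - {y})"
proof -
  have "\<exists>C. C \<subseteq> I \<and> e \<in> span C" using assms by blast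
  then obtain C where C: "C \<subseteq> I" "e \<in> span C"
    and min: "\<And>D. D \<subseteq> I \<Longrightarrow> e \<in> span D \<Longrightarrow> card C \<le> card D"
    using ex_has_least_nat[of "\<lambda>C. C \<subseteq> I \<and> e \<in> span C" _ card] by metis
  have "\<not> C \<subseteq> S" using C assms(4) span_mono[of C "I \<inter> S"] by blast
  then obtain y where y: "y \<in> C" "y \<notin> S" by blast
  have finC: "finite C" using C assms finite_subset by blast
  have "e \<notin> span (C - {y})"
  proof
    assume "e \<in> span (C - {y})"
    then have "card C \<le> card (C - {y})" using C by (intro min) auto
    then show False using y finC by (metis card_Diff1_less not_less)
  qed
  moreover have "insert y (C - {y}) = C" using y by auto
  ultimately have ye: "y \<in> span (insert e (C - {y}))" using exchange C by metis
  \<comment> \<open>Since \<open>insert e (C - {y})\<close> spans \<open>y\<close>, a set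
    \<open>I - {y}\<close> still spanning \<open>e\<close> would span \<open>y\<close> as well,
    against independence of \<open>I\<close>.\<close>
  have "e \<notin> span (I - {y})"
  proof
    assume e: "e \<in> span (I - {y})"
    have "insert e (C - {y}) \<subseteq> span (I - {y})"
      using e C extensive[of "I - {y}"] by blast
    then have "y \<in> span (I - {y})" using span_minimal ye by blast
    then show False using assms(2) y C by (auto simp: indep_def)
  qed
  then show ?thesis using that y C by blast
qed

definition indep_partition :: "nat \<Rightarrow> (nat \<Rightarrow> 'e set) \<Rightarrow> 'e set \<Rightarrow> bool" where
  "indep_partition r I A \<longleftrightarrow> (\<Union>i<r. I i) = A \<and>
     (\<forall>i<r. \<forall>j<r. i \<noteq> j \<longrightarrow> I i \<inter> I j = {}) \<and> (\<forall>i<r. indep (I i))"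

text \<open>Serves both for adding \<open>e\<close> to a class and for swapping it with some
  \<open>y\<close>. The condition on \<open>X \<inter> A\<close> keeps \<open>X\<close> disjoint
  from the other classes.\<close>

lemma indep_partition_update:
  assumes "indep_partition r I A" "i < r" "X \<inter> A \<subseteq> I i" "indep X"
  shows "indep_partition r (I(i := X)) (A - I i \<union> X)"
proof -
  have 1: "(\<Union>i<r. I i) = A" and 2: "\<And>i j. i < r \<Longrightarrow> j < r \<Longrightarrow> i \<noteq> j \<Longrightarrow> I i \<inter> I j = {}"
    and 3: "\<And>i. i < r \<Longrightarrow> indep (I i)"
    using assms(1) unfolding indep_partition_def by blast+
  have X: "X \<inter> I j = {}" if "j < r" "j \<noteq> i" for j
    using assms(3) 1 2[of i j] that assms(2) by blast
  have "(\<Union>j<r. (I(i := X)) j) = A - I i \<union> X"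
  proof (intro set_eqI iffI)
    fix x assume "x \<in> (\<Union>j<r. (I(i := X)) j)"
    then obtain j where j: "j < r" "x \<in> (I(i := X)) j" by blast
    show "x \<in> A - I i \<union> X"
    proof (cases "j = i")
      case False
      then have "x \<in> I j" using j by simp
      then show ?thesis using 1 2[of i j] j assms(2) False by blast
    qed (use j in simp)
  next
    fix x assume x: "x \<in> A - I i \<union> X"
    show "x \<in> (\<Union>j<r. (I(i := X)) j)"
    proof (cases "x \<in> X")
      case True then show ?thesis using assms(2) by force
    next
      case False
      then have "x \<in> A" "x \<notin> I i" using x by auto
      then obtain j where "j < r" "x \<in> I j" using 1 by blast
      then show ?thesis using \<open>x \<notin> I i\<close> by force
    qed
  qed
  moreover have "(I(i := X)) a \<inter> (I(i := X)) b = {}" if "a < r" "b < r" "a \<noteq> b" for a b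
    using that 2[of a b] X[of a] X[of b] by (auto split: if_splits)
  moreover have "indep ((I(i := X)) a)" if "a < r" for a using 3[OF that] assms(4) by simp
  ultimately show ?thesis unfolding indep_partition_def by blast
qed

primrec level :: "'e set \<Rightarrow> nat \<Rightarrow> (nat \<Rightarrow> 'e set) \<Rightarrow> nat \<Rightarrow> 'e set" where
  "level E r I 0 = E"
| "level E r I (Suc j) = level E r I j \<inter> {x. \<forall>i<r. x \<in> span (I i \<inter> level E r I j)}"

lemma level_decseq: "i \<le> j \<Longrightarrow> level E r I j \<subseteq> level E r I i"
  by (induction j) (auto simp: le_Suc_eq)

text \<open>
  If \<open>e\<close> leaves the levels at step \<open>Suc j\<close>, exchanging it for some \<open>y\<close> outside \<open>level E r I j\<close>
  does not enlarge the levels up to \<open>j\<close>, so that the newly uncovered \<open>y\<close> leaves them earlier.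
\<close>

lemma indep_partition_augment:
  assumes "finite E" "indep_partition r I (E - {e})" "e \<in> E" "e \<notin> level E r I j"
  shows "\<exists>I. indep_partition r I E"
  using assms(2-)
proof (induction j arbitrary: I e)
  case 0
  then show ?case by simp
next
  case (Suc j)
  show ?case
  proof (cases "e \<in> level E r I j")
    case False
    then show ?thesis using Suc by blast
  next
    case True
    then obtain i where i: "i < r" "e \<notin> span (I i \<inter> level E r I j)"
      using Suc.prems by auto
    have sub: "I i \<subseteq> E - {e}" and ind: "indep (I i)"
      using Suc.prems(1) i unfolding indep_partition_def by blast+
    show ?thesis
    proof (cases "e \<in> span (I i)")
      case False
      have "indep (insert e (I i))" using indep_insert ind False by blast
      then have "indep_partition r (I(i := insert e (I i))) (E - {e} - I i \<union> insert e (I i))"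
        by (intro indep_partition_update[OF Suc.prems(1) i(1)]) auto
      moreover have "E - {e} - I i \<union> insert e (I i) = E" using sub Suc.prems(2) by blast
      ultimately show ?thesis by metis
    next
      case True': True
      have "finite (I i)" using sub assms(1) finite_subset by blast
      then obtain y where y: "y \<in> I i" "y \<notin> level E r I j" "e \<notin> span (I i - {y})"
        using exchange_outside ind True' i(2) by blast
      define X where "X = insert e (I i - {y})"
      define I' where "I' = I(i := X)"
      have "indep X"
        unfolding X_def using indep_insert indep_subset[OF ind] y(3) by blast
      then have "indep_partition r I' (E - {e} - I i \<union> X)"
        unfolding I'_def by (intro indep_partition_update[OF Suc.prems(1) i(1)]) (auto simp: X_def)
      moreover have "E - {e} - I i \<union> X = E - {y}"
        using sub Suc.prems(2) y(1) unfolding X_def by blast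
      ultimately have part: "indep_partition r I' (E - {y})" by simp
      have "level E r I' l \<subseteq> level E r I l" if "l \<le> j" for l
        using that
      proof (induction l)
        case (Suc l)
        let ?L = "level E r I l" and ?L' = "level E r I' l"
        have IH: "?L' \<subseteq> ?L" using Suc by simp
        \<comment> \<open>As \<open>Suc l \<le> j\<close>, the element \<open>e\<close> has survived
          one level beyond \<open>l\<close>, so class \<open>i\<close> already spans it inside
          \<open>?L\<close> and gains nothing from receiving it.\<close>
        have "e \<in> level E r I (Suc l)" using True level_decseq Suc.prems by blast
        then have e: "e \<in> span (I i \<inter> ?L)" using i(1) by simp
        have "span (I' a \<inter> ?L') \<subseteq> span (I a \<inter> ?L)" if "a < r" for a
        proof (cases "a = i")
          case True
          have "I' i \<inter> ?L' \<subseteq> insert e (I i \<inter> ?L)" using IH by (auto simp: I'_def X_def)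
          also have "\<dots> \<subseteq> span (I i \<inter> ?L)" using e extensive by blast
          finally show ?thesis using True span_minimal by blast
        next
          case False
          then show ?thesis using IH by (intro span_mono) (auto simp: I'_def)
        qed
        then show ?case using IH by auto
      qed simp
      then have "y \<notin> level E r I' j" using y(2) by blast
      then show ?thesis using Suc.IH[OF part] y(1) sub by blast
    qed
  qed
qed

text \<open>
  In the second case \<open>S\<close> violates the bound \<open>card S \<le> r * rank S\<close>: every \<open>I i \<inter> S\<close> is a basis of \<open>S\<close>.
\<close>

lemma indep_partition_insert:
  assumes "finite E" "indep_partition r I (E - {e})" "e \<in> E"
  obtains J where "indep_partition r J E"
  | S where "e \<in> S" "S \<subseteq> E" "\<And>i. i < r \<Longrightarrow> S \<subseteq> span (I i \<inter> S)"
proof (cases "\<exists>j. e \<notin> level E r I j")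
  case True
  then show ?thesis using indep_partition_augment assms that(1) by blast
next
  case False
  \<comment> \<open>A level of least cardinality: the levels decrease and are finite, so the next
    one must equal it.\<close>
  obtain j where j: "\<And>l. card (level E r I j) \<le> card (level E r I l)"
    using ex_has_least_nat[of "\<lambda>_. True" 0 "\<lambda>j. card (level E r I j)"] by auto
  have sub: "level E r I j \<subseteq> E" using level_decseq[of 0 j E r I] by simp
  have "level E r I (Suc j) \<subseteq> level E r I j" by (rule level_decseq) simp
  then have "level E r I (Suc j) = level E r I j"
    using j[of "Suc j"] finite_subset[OF sub assms(1)] by (intro card_seteq)
  then have "level E r I j \<subseteq> span (I i \<inter> level E r I j)" if "i < r" for i using that by auto
  then show ?thesis using that(2)[of "level E r I j"] False sub by blast
qed

end

section \<open>The Nash-Williams arboricity theorem\<close>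

definition conn :: "'a set set \<Rightarrow> ('a \<times> 'a) set" where
  "conn F = {(u, v). {u, v} \<in> F}\<^sup>*"

text \<open>Keeping all of \<open>F\<close> makes this a closure operator even if \<open>F\<close> has members that are not edges.\<close>

definition edge_span :: "'a set set \<Rightarrow> 'a set set" where
  "edge_span F = F \<union> {{u, v} | u v. (u, v) \<in> conn F}"

lemma conn_refl [simp]: "(u, u) \<in> conn F"
  by (simp add: conn_def)

lemma conn_edge: "{u, v} \<in> F \<Longrightarrow> (u, v) \<in> conn F"
  by (auto simp: conn_def)

lemma conn_trans: "(u, v) \<in> conn F \<Longrightarrow> (v, w) \<in> conn F \<Longrightarrow> (u, w) \<in> conn F"
  by (auto simp: conn_def)

lemma conn_sym: "(u, v) \<in> conn F \<Longrightarrow> (v, u) \<in> conn F"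
proof -
  have "sym {(u, v). {u, v} \<in> F}" by (auto simp: sym_def insert_commute)
  then show "(u, v) \<in> conn F \<Longrightarrow> (v, u) \<in> conn F"
    unfolding conn_def using sym_rtrancl symD by metis
qed

lemma conn_mono: "F \<subseteq> F' \<Longrightarrow> conn F \<subseteq> conn F'"
  unfolding conn_def by (rule rtrancl_mono) auto

lemma mem_edge_span_iff: "{u, v} \<in> edge_span F \<longleftrightarrow> (u, v) \<in> conn F"
proof
  assume "{u, v} \<in> edge_span F"
  then show "(u, v) \<in> conn F"
    unfolding edge_span_def using conn_sym by (auto simp: doubleton_eq_iff intro: conn_edge)
qed (auto simp: edge_span_def)

lemma conn_subset:
  assumes "F \<subseteq> edge_span F'"
  shows "conn F \<subseteq> conn F'"
proof -
  have "(u, v) \<in> conn F'" if "{u, v} \<in> F" for u v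
    using that assms mem_edge_span_iff[of u v F'] by blast
  then have "{(u, v). {u, v} \<in> F} \<subseteq> conn F'" by auto
  then show ?thesis unfolding conn_def by (rule rtrancl_subset_rtrancl)
qed

text \<open>A walk need cross the new edge at most once: crossing it again leads to an endpoint that
  was reachable before.\<close>

lemma conn_insert:
  assumes "(a, b) \<in> conn (insert {u, v} F)"
  shows "(a, b) \<in> conn F \<or> (a, u) \<in> conn F \<and> (v, b) \<in> conn F \<or> (a, v) \<in> conn F \<and> (u, b) \<in> conn F"
  using assms unfolding conn_def
proof (induction rule: rtrancl_induct)
  case base
  then show ?case by simp
next
  case (step y z)
  then have "{y, z} = {u, v} \<or> {y, z} \<in> F" by simp
  then show ?case
  proof
    assume "{y, z} = {u, v}"
    then have "y = u \<and> z = v \<or> y = v \<and> z = u" by (auto simp: doubleton_eq_iff)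
    then show ?thesis using step.IH conn_refl[unfolded conn_def] by blast
  next
    assume "{y, z} \<in> F"
    then have "(y, z) \<in> {(u, v). {u, v} \<in> F}" by simp
    then show ?thesis using step.IH by (meson rtrancl.rtrancl_into_rtrancl)
  qed
qed

text \<open>The graphic matroid. If \<open>a\<close> and \<open>b\<close> become connected only
  through \<open>{u, v}\<close>, then the new edge \<open>{a, b}\<close> and the two remaining
  pieces of the walk connect \<open>u\<close> to \<open>v\<close>.\<close>

interpretation edge_span: pregeometry edge_span
proof
  fix A B :: "'a set set" and e y :: "'a set"
  show "A \<subseteq> edge_span A" by (simp add: edge_span_def)
  show "edge_span A \<subseteq> edge_span B" if "A \<subseteq> B"
    using that conn_mono[OF that] unfolding edge_span_def by blast
  have "conn (edge_span A) \<subseteq> conn A" by (rule conn_subset) simp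
  then show "edge_span (edge_span A) = edge_span A"
    unfolding edge_span_def[of "edge_span A"] by (auto simp: mem_edge_span_iff)
  assume e: "e \<in> edge_span (insert y A)" "e \<notin> edge_span A"
  show "y \<in> edge_span (insert e A)"
  proof (cases "e = y")
    case True
    then show ?thesis by (simp add: edge_span_def)
  next
    case False
    then obtain a b where ab: "e = {a, b}" "(a, b) \<in> conn (insert y A)"
      using e by (auto simp: edge_span_def)
    have nab: "(a, b) \<notin> conn A" using e ab by (simp add: mem_edge_span_iff)
    \<comment> \<open>Any other \<open>y\<close> contributes no step to \<open>conn\<close> and
      could not have connected \<open>a\<close> to \<open>b\<close>.\<close>
    have "\<exists>u v. y = {u, v}"
    proof (rule ccontr)
      assume "\<nexists>u v. y = {u, v}"
      then have "conn (insert y A) = conn A" unfolding conn_def by (intro arg_cong[of _ _ rtrancl]) auto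
      then show False using ab nab by simp
    qed
    then obtain u v where y: "y = {u, v}" by blast
    have up: "(c, d) \<in> conn (insert e A)" if "(c, d) \<in> conn A" for c d
      using conn_mono[of A "insert e A"] that by blast
    have ea: "(a, b) \<in> conn (insert e A)" by (rule conn_edge) (simp add: ab)
    have "(a, u) \<in> conn A \<and> (v, b) \<in> conn A \<or> (a, v) \<in> conn A \<and> (u, b) \<in> conn A"
      using conn_insert[of a b u v A] ab(2) y nab by simp
    then have "(u, v) \<in> conn (insert e A)"
    proof (elim disjE conjE)
      assume "(a, u) \<in> conn A" "(v, b) \<in> conn A"
      then have "(u, a) \<in> conn (insert e A)" "(b, v) \<in> conn (insert e A)"
        by (simp_all add: up conn_sym)
      with ea show ?thesis by (meson conn_trans)
    next
      assume "(a, v) \<in> conn A" "(u, b) \<in> conn A"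
      then have "(b, u) \<in> conn (insert e A)" "(v, a) \<in> conn (insert e A)"
        by (simp_all add: up conn_sym)
      with ea have "(v, u) \<in> conn (insert e A)" by (meson conn_trans)
      then show ?thesis by (rule conn_sym)
    qed
    then show ?thesis by (simp add: y mem_edge_span_iff)
  qed
qed

text \<open>The closing edge of a cycle lies in the span of the other edges, which form a path
  between its ends.\<close>

lemma forest_if_indep:
  assumes "edge_span.indep F"
  shows "forest F"
  unfolding forest_def
proof (rule notI, elim exE)
  fix vs assume "is_cycle F vs"
  then have L: "3 \<le> length vs" and d: "distinct vs"
    and F: "\<And>i. i < length vs \<Longrightarrow> {vs ! i, vs ! (Suc i mod length vs)} \<in> F"
    by (simp_all add: is_cycle_def)
  define l where "l = length vs - 1"
  let ?e = "{vs ! l, vs ! 0}"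
  have Suc_l: "Suc l = length vs" and l: "l < length vs" "2 \<le> l" using L by (auto simp: l_def)
  have e: "?e \<in> F" using F[of l] l Suc_l by simp
  have "(vs ! 0, vs ! i) \<in> conn (F - {?e})" if "i \<le> l" for i
    using that
  proof (induction i)
    case (Suc i)
    have i: "Suc i < length vs" using Suc l by simp
    then have "{vs ! i, vs ! Suc i} \<in> F" using F[of i] by simp
    \<comment> \<open>For \<open>i = 0\<close> both edges contain \<open>vs ! 0\<close>, and
      \<open>2 \<le> l\<close> separates \<open>vs ! 1\<close> from \<open>vs ! l\<close>; for
      \<open>i \<noteq> 0\<close> the vertex \<open>vs ! i\<close> is not an end of
      \<open>?e\<close>.\<close>
    moreover have "{vs ! i, vs ! Suc i} \<noteq> ?e"
    proof -
      have neq: "vs ! p \<noteq> vs ! q" if "p < length vs" "q < length vs" "p \<noteq> q" for p q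
        using that d by (simp add: nth_eq_iff_index_eq)
      have "vs ! i \<noteq> vs ! l" using Suc.prems l by (intro neq) auto
      moreover have "vs ! Suc i \<noteq> vs ! l" if "i = 0" using that l by (intro neq) auto
      moreover have "vs ! i \<noteq> vs ! 0" if "i \<noteq> 0" using that i by (intro neq) auto
      ultimately show ?thesis unfolding doubleton_eq_iff by metis
    qed
    ultimately have "(vs ! i, vs ! Suc i) \<in> conn (F - {?e})" by (intro conn_edge) simp
    moreover have "(vs ! 0, vs ! i) \<in> conn (F - {?e})" using Suc by simp
    ultimately show ?case by (rule conn_trans[rotated])
  qed simp
  then have "?e \<in> edge_span (F - {?e})" unfolding mem_edge_span_iff by (rule conn_sym) simp
  then show False using assms e unfolding edge_span.indep_def by blast
qed

text \<open>A maximal \<open>T \<ni> a\<close> inside the component with \<open>card T - 1\<close> edges has no edge leaving it.\<close>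

lemma card_component_le:
  assumes "finite F" "finite W" "W = {w. (a, w) \<in> conn F}"
  shows "card W \<le> Suc (card {f \<in> F. f \<subseteq> W})"
proof -
  let ?P = "\<lambda>T. T \<subseteq> W \<and> a \<in> T \<and> card T \<le> Suc (card {f \<in> F. f \<subseteq> T})"
  have "?P {a}" using assms by simp
  moreover have "card T \<le> card W" if "?P T" for T using that assms by (intro card_mono) auto
  ultimately obtain T where T: "?P T" and max: "\<And>T'. ?P T' \<Longrightarrow> card T' \<le> card T"
    using ex_has_greatest_nat[of ?P "{a}" card "Suc (card W)"] by (auto simp: less_Suc_eq_le)
  have finT: "finite T" using T assms finite_subset by blast
  have "w \<in> T" if "(a, w) \<in> conn F" for w
    using that unfolding conn_def
  proof (induction rule: rtrancl_induct)
    case base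
    then show ?case using T by simp
  next
    case (step x y)
    show ?case
    proof (rule ccontr)
      assume y: "y \<notin> T"
      have f: "{x, y} \<in> F" using step by simp
      have "(a, x) \<in> conn F" using step T assms by blast
      then have "y \<in> W" using conn_trans[OF _ conn_edge[OF f]] assms(3) by simp
      have "insert {x, y} {f \<in> F. f \<subseteq> T} \<subseteq> {f \<in> F. f \<subseteq> insert y T}" using f step by auto
      then have "card (insert {x, y} {f \<in> F. f \<subseteq> T}) \<le> card {f \<in> F. f \<subseteq> insert y T}"
        using assms by (intro card_mono) auto
      moreover have "card (insert {x, y} {f \<in> F. f \<subseteq> T}) = Suc (card {f \<in> F. f \<subseteq> T})"
        using assms y by (intro card_insert_disjoint) auto
      ultimately have "?P (insert y T)" using T \<open>y \<in> W\<close> y finT by auto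
      then show False using max[of "insert y T"] y finT by simp
    qed
  qed
  then have "T = W" using T assms by blast
  then show ?thesis using T by simp
qed

text \<open>Edges are added one by one. If \<open>e\<close> cannot be accommodated, some
  \<open>S\<close> containing \<open>e\<close> is spanned by each class, and the component of
  \<open>e\<close> in \<open>S\<close> carries too many edges: a connecting set from every class,
  and \<open>e\<close> itself.\<close>

theorem nash_williams:
  assumes "finite E" and edge: "\<And>e. e \<in> E \<Longrightarrow> \<exists>u v. u \<noteq> v \<and> e = {u, v}"
    and dens: "\<And>W. W \<subseteq> \<Union>E \<Longrightarrow> 2 \<le> card W \<Longrightarrow> card {e \<in> E. e \<subseteq> W} \<le> r * (card W - 1)"
  shows "\<exists>I. edge_span.indep_partition r I E"
  using assms
proof (induction E rule: finite_induct)
  case empty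
  then show ?case
    by (intro exI[of _ "\<lambda>_. {}"]) (simp add: edge_span.indep_partition_def edge_span.indep_def)
next
  case (insert e E)
  let ?E = "insert e E"
  have "card {e \<in> E. e \<subseteq> W} \<le> r * (card W - 1)" if "W \<subseteq> \<Union>E" "2 \<le> card W" for W
  proof -
    have "card {e \<in> E. e \<subseteq> W} \<le> card {f \<in> ?E. f \<subseteq> W}"
      using insert.hyps by (intro card_mono) auto
    also have "\<dots> \<le> r * (card W - 1)" using that by (intro insert.prems(2)) auto
    finally show ?thesis .
  qed
  then obtain I where I: "edge_span.indep_partition r I E" using insert.IH insert.prems(1) by auto
  have fin: "finite ?E" using insert by simp
  have "?E - {e} = E" using insert by simp
  then have I': "edge_span.indep_partition r I (?E - {e})" using I by simp
  show ?case
  proof (rule edge_span.indep_partition_insert[OF fin I'])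
    fix J assume "edge_span.indep_partition r J ?E"
    then show ?thesis by (intro exI[of _ J])
  next
    fix S assume S: "e \<in> S" "S \<subseteq> ?E" and sp: "\<And>i. i < r \<Longrightarrow> S \<subseteq> edge_span (I i \<inter> S)"
    obtain a b where ab: "a \<noteq> b" "e = {a, b}" using insert.prems(1) by blast
    define W where "W = {w. (a, w) \<in> conn S}"
    have finS: "finite S" using S fin finite_subset by blast
    have W: "W \<subseteq> \<Union>?E"
    proof
      fix w assume "w \<in> W"
      then have "(a, w) \<in> {(u, v). {u, v} \<in> S}\<^sup>*" by (simp add: W_def conn_def)
      then show "w \<in> \<Union>?E"
      proof cases
        case base
        then show ?thesis using ab by simp
      next
        case (step y)
        then have "{y, w} \<in> ?E" using S by blast
        then show ?thesis by blast
      qed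
    qed
    have "finite (\<Union>?E)" using insert.prems(1) fin by (metis finite_Union finite.simps)
    then have finW: "finite W" using W finite_subset by blast
    have ab_W: "a \<in> W" "b \<in> W" using S ab by (auto simp: W_def intro: conn_edge)
    then have cardW: "2 \<le> card W" using card_mono[of W "{a, b}"] finW ab by simp
    \<comment> \<open>\<open>I i \<inter> S\<close> spans \<open>S\<close>, so both have the same
      component \<open>W\<close> at \<open>a\<close>, and connecting \<open>W\<close> takes at least
      \<open>card W - 1\<close> edges.\<close>
    have card_I: "card W - 1 \<le> card {f \<in> I i \<inter> S. f \<subseteq> W}" if "i < r" for i
    proof -
      have "conn S = conn (I i \<inter> S)" using conn_subset[OF sp[OF that]] conn_mono[of "I i \<inter> S" S] by auto
      then have "W = {w. (a, w) \<in> conn (I i \<inter> S)}" by (simp add: W_def)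
      then show ?thesis using card_component_le[of "I i \<inter> S" W a] finS finW by simp
    qed
    let ?U = "\<Union>i<r. {f \<in> I i \<inter> S. f \<subseteq> W}"
    have "r * (card W - 1) = (\<Sum>i<r. card W - 1)" by simp
    also have "\<dots> \<le> (\<Sum>i<r. card {f \<in> I i \<inter> S. f \<subseteq> W})" by (intro sum_mono card_I) simp
    also have "\<dots> = card ?U"
      using I finS unfolding edge_span.indep_partition_def
      by (intro card_UN_disjoint[symmetric]) (auto 0 4)
    \<comment> \<open>Strict because \<open>e\<close> is new: the classes cover only
      \<open>E\<close>.\<close>
    also have "\<dots> < card (insert e ?U)"
    proof -
      have "e \<notin> ?U" using I insert.hyps unfolding edge_span.indep_partition_def by blast
      moreover have "finite ?U" using finS by auto
      ultimately show ?thesis by simp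
    qed
    also have "\<dots> \<le> card {f \<in> ?E. f \<subseteq> W}"
      using S ab ab_W fin by (intro card_mono) auto
    also have "\<dots> \<le> r * (card W - 1)" using W cardW by (rule insert.prems(2))
    finally show ?thesis by simp
  qed simp
qed

corollary arboricity_le:
  assumes G: "simple_graph G"
    and dens: "\<And>W. W \<subseteq> fst G \<Longrightarrow> 2 \<le> card W \<Longrightarrow> card {e \<in> snd G. e \<subseteq> W} \<le> r * (card W - 1)"
  shows "arboricity G \<le> r"
proof -
  have fin_V: "finite (fst G)"
    and ex: "\<And>e. e \<in> snd G \<Longrightarrow> \<exists>u\<in>fst G. \<exists>v\<in>fst G. u \<noteq> v \<and> e = {u, v}"
    using G by (simp_all add: simple_graph_def)
  have edge: "\<exists>u v. u \<noteq> v \<and> e = {u, v}" if "e \<in> snd G" for e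
    using ex[OF that] by blast
  have sub: "snd G \<subseteq> Pow (fst G)"
  proof
    fix e assume "e \<in> snd G"
    from ex[OF this] show "e \<in> Pow (fst G)" by blast
  qed
  then have fin: "finite (snd G)" using fin_V by (simp add: finite_subset)
  have "card {e \<in> snd G. e \<subseteq> W} \<le> r * (card W - 1)" if "W \<subseteq> \<Union>(snd G)" "2 \<le> card W" for W
  proof (rule dens)
    show "W \<subseteq> fst G" using that(1) sub by blast
  qed (rule that(2))
  with fin edge have "\<exists>I. edge_span.indep_partition r I (snd G)" by (rule nash_williams)
  then obtain I where "edge_span.indep_partition r I (snd G)" by (elim exE)
  then have "forest_decomposition G r I"
    unfolding edge_span.indep_partition_def forest_decomposition_def by (simp add: forest_if_indep)
  then have "\<exists>F. forest_decomposition G r F" by (intro exI[of _ I])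
  then show ?thesis unfolding arboricity_def by (intro Least_le)
qed

section \<open>Counting homomorphisms\<close>

text \<open>
  Numbering the \<open>2 * n + m\<close> ways in which \<open>v\<close> can be joined to \<open>u\<close>: below \<open>n\<close> an arc from \<open>u\<close> to
  \<open>v\<close>, below \<open>2 * n\<close> an arc from \<open>v\<close> to \<open>u\<close>, otherwise an edge. \<open>flip\<close> exchanges \<open>u\<close> and \<open>v\<close>.
\<close>

definition joined :: "nat \<Rightarrow> 'a nm_graph \<Rightarrow> nat \<Rightarrow> 'a \<Rightarrow> 'a \<Rightarrow> bool" where
  "joined n G c u v \<longleftrightarrow>
     (if c < n then (u, v) \<in> arcs G (2 * (c + 1))
      else if c < 2 * n then (v, u) \<in> arcs G (2 * (c - n + 1))
      else {u, v} \<in> edges G (c + 1))"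

definition flip :: "nat \<Rightarrow> nat \<Rightarrow> nat" where
  "flip n c = (if c < n then c + n else if c < 2 * n then c - n else c)"

lemma flip_flip [simp]: "flip n (flip n c) = c"
  by (auto simp: flip_def)

lemma flip_less: "c < 2 * n + m \<Longrightarrow> flip n c < 2 * n + m"
  by (auto simp: flip_def)

lemma joined_flip: "joined n G (flip n c) v u \<longleftrightarrow> joined n G c u v"
  by (auto simp: flip_def joined_def insert_commute)

lemma joined_hom: "nm_hom G H f \<Longrightarrow> joined n G c u v \<Longrightarrow> joined n H c (f u) (f v)"
  unfolding nm_hom_def joined_def by (auto split: if_splits)

context is_nm_graph
begin

text \<open>Two different numbers would contradict one of the uniqueness assumptions. Hence the
  colour of an edge can be recovered from its image in a target.\<close>

lemma joined_unique:
  assumes "joined n G c u v" "joined n G d u v"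
  shows "c = d"
proof -
  have edge: False if "{u, v} \<in> edges G b" "(u, v) \<in> arcs G a \<or> (v, u) \<in> arcs G a" for a b
    using that no_arc_and_edge by (metis insert_commute)
  show ?thesis
    using assms arc_unique[of u v "2 * (c + 1)" "2 * (d + 1)"]
      arc_unique[of v u "2 * (c - n + 1)" "2 * (d - n + 1)"]
      edge_unique[of "{u, v}" "c + 1" "d + 1"] no_opposite_arc[of u v] no_opposite_arc[of v u] edge
    unfolding joined_def by (auto split: if_splits)
qed

lemma joined_ends:
  assumes "joined n G c u v"
  shows "u \<in> verts G" "v \<in> verts G" "u \<noteq> v"
proof -
  have "u \<in> verts G \<and> v \<in> verts G \<and> u \<noteq> v" if uv: "{u, v} \<in> edges G a" for a
  proof -
    obtain x y where "x \<in> verts G" "y \<in> verts G" "x \<noteq> y" "{u, v} = {x, y}"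
      using edge_ends[OF uv] by blast
    then show ?thesis by (auto simp: doubleton_eq_iff)
  qed
  then have "u \<in> verts G \<and> v \<in> verts G \<and> u \<noteq> v"
    using assms arc_ends[of u v "2 * (c + 1)"] arc_ends[of v u "2 * (c - n + 1)"]
    unfolding joined_def by (auto split: if_splits)
  then show "u \<in> verts G" "v \<in> verts G" "u \<noteq> v" by simp_all
qed

end

section \<open>Relabelling of vertices and elementary bounds on \<open>chi_nm\<close>\<close>

definition map_nm :: "('a \<Rightarrow> 'b) \<Rightarrow> 'a nm_graph \<Rightarrow> 'b nm_graph" where
  "map_nm g G = \<lparr>verts = g ` verts G, arcs = \<lambda>a. map_prod g g ` arcs G a,
     edges = \<lambda>a. (`) g ` edges G a\<rparr>"

lemma nm_hom_map_nm: "nm_hom G (map_nm g G) g"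
  unfolding nm_hom_def map_nm_def by (auto intro: rev_image_eqI)

lemma is_nm_graph_map_nm:
  assumes G: "is_nm_graph n m G" and inj: "inj_on g (verts G)"
  shows "is_nm_graph n m (map_nm g G)"
proof -
  interpret is_nm_graph n m G by (rule G)
  have arcD: "\<exists>x y. u = g x \<and> v = g y \<and> (x, y) \<in> arcs G a \<and> x \<in> verts G \<and> y \<in> verts G \<and> x \<noteq> y"
    if "(u, v) \<in> arcs (map_nm g G) a" for u v a
    using that arc_ends by (force simp: map_nm_def)
  have edgeD: "\<exists>x y. e = {g x, g y} \<and> {x, y} \<in> edges G a \<and> x \<in> verts G \<and> y \<in> verts G \<and> x \<noteq> y"
    if e: "e \<in> edges (map_nm g G) a" for e a
  proof -
    obtain e' where e': "e' \<in> edges G a" "e = g ` e'" using e by (auto simp: map_nm_def)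
    then obtain x y where "x \<in> verts G" "y \<in> verts G" "x \<noteq> y" "e' = {x, y}"
      using edge_ends by blast
    then show ?thesis using e' by auto
  qed
  have eq: "g x = g y \<longleftrightarrow> x = y" if "x \<in> verts G" "y \<in> verts G" for x y
    using inj that by (auto simp: inj_on_def)
  show ?thesis
  proof
    show "finite (verts (map_nm g G))" using finite_verts by (simp add: map_nm_def)
  next
    fix u v a assume "(u, v) \<in> arcs (map_nm g G) a"
    then show "a \<in> arc_types n" using arcD arc_type by blast
  next
    fix e a assume "e \<in> edges (map_nm g G) a"
    then show "a \<in> edge_types n m" using edgeD edge_type by blast
  next
    fix u v a assume "(u, v) \<in> arcs (map_nm g G) a"
    from arcD[OF this] show "u \<in> verts (map_nm g G) \<and> v \<in> verts (map_nm g G) \<and> u \<noteq> v"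
      using eq by (auto simp: map_nm_def)
  next
    fix e a assume "e \<in> edges (map_nm g G) a"
    from edgeD[OF this] obtain x y
      where "e = {g x, g y}" "x \<in> verts G" "y \<in> verts G" "x \<noteq> y" by blast
    then show "\<exists>u\<in>verts (map_nm g G). \<exists>v\<in>verts (map_nm g G). u \<noteq> v \<and> e = {u, v}"
      using eq[of x y] by (intro bexI[of _ "g x"] bexI[of _ "g y"]) (auto simp: map_nm_def)
  next
    fix u v a b assume 1: "(u, v) \<in> arcs (map_nm g G) a" and 2: "(u, v) \<in> arcs (map_nm g G) b"
    from arcD[OF 1] obtain x y where 3: "u = g x" "v = g y" "(x, y) \<in> arcs G a" "x \<in> verts G" "y \<in> verts G"
      by blast
    from arcD[OF 2] obtain x' y' where 4: "u = g x'" "v = g y'" "(x', y') \<in> arcs G b" "x' \<in> verts G" "y' \<in> verts G"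
      by blast
    have "x = x'" "y = y'" using 3 4 eq by auto
    then show "a = b" using 3 4 arc_unique by blast
  next
    fix e a b assume 1: "e \<in> edges (map_nm g G) a" and 2: "e \<in> edges (map_nm g G) b"
    from edgeD[OF 1] obtain x y where 3: "e = {g x, g y}" "{x, y} \<in> edges G a" "x \<in> verts G" "y \<in> verts G"
      by blast
    from edgeD[OF 2] obtain x' y' where 4: "e = {g x', g y'}" "{x', y'} \<in> edges G b" "x' \<in> verts G" "y' \<in> verts G"
      by blast
    have "{x, y} = {x', y'}" using 3 4 eq by (auto simp: doubleton_eq_iff)
    then show "a = b" using 3 4 edge_unique by metis
  next
    fix u v a b assume 1: "(u, v) \<in> arcs (map_nm g G) a"
    from arcD[OF 1] obtain x y where 3: "u = g x" "v = g y" "(x, y) \<in> arcs G a" "x \<in> verts G" "y \<in> verts G"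
      by blast
    show "(v, u) \<notin> arcs (map_nm g G) b"
    proof
      assume 2: "(v, u) \<in> arcs (map_nm g G) b"
      from arcD[OF 2] obtain x' y' where 4: "v = g x'" "u = g y'" "(x', y') \<in> arcs G b" "x' \<in> verts G" "y' \<in> verts G"
        by blast
      have "x = y'" "y = x'" using 3 4 eq by auto
      then show False using 3 4 no_opposite_arc by blast
    qed
  next
    fix u v a b assume 1: "(u, v) \<in> arcs (map_nm g G) a"
    from arcD[OF 1] obtain x y where 3: "u = g x" "v = g y" "(x, y) \<in> arcs G a" "x \<in> verts G" "y \<in> verts G"
      by blast
    show "{u, v} \<notin> edges (map_nm g G) b"
    proof
      assume 2: "{u, v} \<in> edges (map_nm g G) b"
      from edgeD[OF 2] obtain x' y' where 4: "{u, v} = {g x', g y'}" "{x', y'} \<in> edges G b" "x' \<in> verts G" "y' \<in> verts G"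
        by blast
      have "{x, y} = {x', y'}" using 3 4 eq by (auto simp: doubleton_eq_iff)
      then show False using 3 4 no_arc_and_edge by metis
    qed
  qed
qed

text \<open>Shows that the \<open>LEAST\<close> in \<open>chi_nm\<close> ranges over a nonempty
  set.\<close>

lemma hom_to_nat_graph:
  assumes "is_nm_graph n m G"
  shows "\<exists>H :: nat nm_graph. is_nm_graph n m H \<and> card (verts H) = card (verts G) \<and> (\<exists>f. nm_hom G H f)"
proof -
  have "finite (verts G)" using assms by (rule is_nm_graph.finite_verts)
  then obtain g :: "'a \<Rightarrow> nat" where "inj_on g (verts G)" using finite_imp_inj_to_nat_seg by metis
  then show ?thesis
    using is_nm_graph_map_nm[OF assms] nm_hom_map_nm[of G g]
    by (intro exI[of _ "map_nm g G"]) (auto simp: map_nm_def card_image)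
qed

lemma chi_nm_le:
  assumes "is_nm_graph n m G"
  shows "chi_nm n m G \<le> card (verts G)"
  using hom_to_nat_graph[OF assms] unfolding chi_nm_def by (rule Least_le)

lemma chi_nm_witness:
  assumes "is_nm_graph n m G"
  obtains H :: "nat nm_graph" and f
  where "is_nm_graph n m H" "card (verts H) = chi_nm n m G" "nm_hom G H f"
proof -
  let ?P = "\<lambda>k. \<exists>H :: nat nm_graph. is_nm_graph n m H \<and> card (verts H) = k \<and> (\<exists>f. nm_hom G H f)"
  have "?P (chi_nm n m G)" unfolding chi_nm_def by (rule LeastI[of ?P]) (rule hom_to_nat_graph[OF assms])
  then show ?thesis using that by blast
qed

text \<open>\<open>und\<close> fixes the vertex set, whose size bounds every value; so the set is
  finite and \<open>Max\<close> is a genuine upper bound.\<close>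

lemma chi_nm_le_simple:
  assumes "is_nm_graph n m G"
  shows "chi_nm n m G \<le> chi_nm_simple n m (und G)"
proof -
  let ?A = "{chi_nm n m G' | G'. is_nm_graph n m G' \<and> und G' = und G}"
  have "?A \<subseteq> {..card (verts G)}"
  proof
    fix x assume "x \<in> ?A"
    then obtain G' where "x = chi_nm n m G'" "is_nm_graph n m G'" "und G' = und G" by blast
    then show "x \<in> {..card (verts G)}" using chi_nm_le[of n m G'] by (simp add: und_def)
  qed
  then have "finite ?A" using finite_subset by blast
  moreover have "chi_nm n m G \<in> ?A" using assms by blast
  ultimately show ?thesis unfolding chi_nm_simple_def by (rule Max_ge)
qed

text \<open>A colour from \<open>n\<close> to \<open>2 * n - 1\<close> yields nothing at
  \<open>(u, v)\<close>: for colourings compatible with \<open>flip\<close>, the pair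
  \<open>(v, u)\<close> then has a colour below \<open>n\<close> and yields the arc.\<close>

definition coloured :: "nat \<Rightarrow> 'a ugraph \<Rightarrow> ('a \<Rightarrow> 'a \<Rightarrow> nat) \<Rightarrow> 'a nm_graph" where
  "coloured n S col = \<lparr>verts = fst S,
     arcs = \<lambda>a. {(u, v). {u, v} \<in> snd S \<and> col u v < n \<and> a = 2 * (col u v + 1)},
     edges = \<lambda>a. {{u, v} | u v. {u, v} \<in> snd S \<and> 2 * n \<le> col u v \<and> a = col u v + 1}\<rparr>"

context
  fixes n m :: nat and S :: "'a ugraph" and col :: "'a \<Rightarrow> 'a \<Rightarrow> nat"
  assumes S: "simple_graph S"
    and col_less: "\<And>u v. {u, v} \<in> snd S \<Longrightarrow> col u v < 2 * n + m"
    and col_swap: "\<And>u v. {u, v} \<in> snd S \<Longrightarrow> col v u = flip n (col u v)"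
begin

text \<open>\<open>flip\<close> fixes the colours from \<open>2 * n\<close> on, so the type does not
  depend on the order in which the ends are read.\<close>

lemma edge_coloured_iff:
  "{u, v} \<in> edges (coloured n S col) a \<longleftrightarrow> {u, v} \<in> snd S \<and> 2 * n \<le> col u v \<and> a = col u v + 1"
proof
  assume "{u, v} \<in> edges (coloured n S col) a"
  then obtain x y where "{u, v} = {x, y}" "{x, y} \<in> snd S" "2 * n \<le> col x y" "a = col x y + 1"
    by (auto simp: coloured_def)
  moreover have "col y x = col x y" using calculation col_swap[of x y] by (simp add: flip_def)
  ultimately show "{u, v} \<in> snd S \<and> 2 * n \<le> col u v \<and> a = col u v + 1"
    by (auto simp: doubleton_eq_iff insert_commute)
qed (auto simp: coloured_def)

lemma arc_coloured_iff:
  "(u, v) \<in> arcs (coloured n S col) a \<longleftrightarrow> {u, v} \<in> snd S \<and> col u v < n \<and> a = 2 * (col u v + 1)"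
  by (auto simp: coloured_def)

lemma ends_S: "{u, v} \<in> snd S \<Longrightarrow> u \<in> fst S \<and> v \<in> fst S \<and> u \<noteq> v"
  using S unfolding simple_graph_def by (fastforce simp: doubleton_eq_iff)

lemma is_nm_graph_coloured: "is_nm_graph n m (coloured n S col)"
proof
  show "finite (verts (coloured n S col))" using S by (simp add: simple_graph_def coloured_def)
next
  fix u v a assume "(u, v) \<in> arcs (coloured n S col) a"
  then show "a \<in> arc_types n" unfolding arc_coloured_iff arc_types_def
    by (auto intro!: exI[of _ "col u v + 1"])
next
  fix e a assume "e \<in> edges (coloured n S col) a"
  then show "a \<in> edge_types n m" using col_less
    by (fastforce simp: coloured_def edge_types_def)
next
  fix u v a assume "(u, v) \<in> arcs (coloured n S col) a"
  then show "u \<in> verts (coloured n S col) \<and> v \<in> verts (coloured n S col) \<and> u \<noteq> v"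
    unfolding arc_coloured_iff using ends_S[of u v] by (simp add: coloured_def)
next
  fix e a assume "e \<in> edges (coloured n S col) a"
  then have "e \<in> snd S" by (auto simp: coloured_def)
  then show "\<exists>u\<in>verts (coloured n S col). \<exists>v\<in>verts (coloured n S col). u \<noteq> v \<and> e = {u, v}"
    using S by (simp add: coloured_def simple_graph_def)
next
  fix e a b assume 1: "e \<in> edges (coloured n S col) a" and 2: "e \<in> edges (coloured n S col) b"
  from 1 obtain u v where "e = {u, v}" by (auto simp: coloured_def)
  then show "a = b" using 1 2 edge_coloured_iff by simp
next
  fix u v a b assume "(u, v) \<in> arcs (coloured n S col) a"
  then show "(v, u) \<notin> arcs (coloured n S col) b"
    unfolding arc_coloured_iff using col_swap[of u v] by (auto simp: flip_def)
qed (auto simp: arc_coloured_iff edge_coloured_iff)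

lemma joined_coloured: "{u, v} \<in> snd S \<Longrightarrow> joined n (coloured n S col) (col u v) u v"
  using col_swap[of u v]
  unfolding joined_def arc_coloured_iff edge_coloured_iff by (auto simp: flip_def insert_commute)

lemma und_coloured: "und (coloured n S col) = S"
proof -
  have "{{u, v} | u v. \<exists>a. (u, v) \<in> arcs (coloured n S col) a} \<union> (\<Union>a. edges (coloured n S col) a) = snd S"
    (is "?L = _")
  proof (intro set_eqI iffI)
    fix e assume "e \<in> ?L"
    then show "e \<in> snd S" by (auto simp: coloured_def)
  next
    fix e assume e: "e \<in> snd S"
    then obtain u v where uv: "e = {u, v}" using S unfolding simple_graph_def by blast
    have "(\<exists>a. (u, v) \<in> arcs (coloured n S col) a) \<or> (\<exists>a. (v, u) \<in> arcs (coloured n S col) a)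
        \<or> (\<exists>a. {u, v} \<in> edges (coloured n S col) a)"
      using joined_coloured[of u v] e uv unfolding joined_def by metis
    then show "e \<in> ?L" unfolding uv by (auto simp: insert_commute)
  qed
  then show ?thesis by (simp add: und_def prod_eq_iff) (simp add: coloured_def)
qed

end

text \<open>
  An edge colouring of the subgraph induced by \<open>W\<close>, read as an \<open>(n,m)\<close>-graph, is determined by a
  homomorphism to a target with vertices below \<open>k\<close> together with the colours of the target.
\<close>

lemma count_edge_colourings:
  assumes p: "1 \<le> 2 * n + m" and S: "simple_graph S" and W: "W \<subseteq> fst S"
    and k: "chi_nm_simple n m S = k"
  shows "(2 * n + m) ^ card {e \<in> snd S. e \<subseteq> W} \<le> k ^ card W * (2 * n + m) ^ (\<Sum>b<k. b)"
proof -
  let ?p = "2 * n + m"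
  define F where "F = {e \<in> snd S. e \<subseteq> W}"
  have finW: "finite W" using S W finite_subset unfolding simple_graph_def by blast
  then have finF: "finite F" unfolding F_def by (rule finite_subset[rotated, OF finite_Pow_iff[THEN iffD2]]) auto
  have "\<exists>s t. \<forall>e\<in>snd S. s e \<noteq> t e \<and> e = {s e, t e}"
    using S unfolding simple_graph_def by metis
  then obtain s t where st: "\<And>e. e \<in> snd S \<Longrightarrow> s e \<noteq> t e" "\<And>e. e \<in> snd S \<Longrightarrow> {s e, t e} = e"
    by metis
  \<comment> \<open>One table entry per pair of target vertices, the larger first;
    \<open>flip\<close> supplies the reverse direction.\<close>
  define P where "P = (SIGMA b:{..<k}. {..<b})"
  \<comment> \<open>The decoder: \<open>s e\<close> and \<open>t e\<close> orient \<open>e\<close>,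
    and its colour is looked up at the image pair, flipped if the images come in the other
    order.\<close>
  define \<Phi> where "\<Phi> = (\<lambda>(f :: 'a \<Rightarrow> nat, h :: nat \<times> nat \<Rightarrow> nat). restrict (\<lambda>e.
      if f (t e) < f (s e) then h (f (s e), f (t e)) else flip n (h (f (t e), f (s e)))) F)"
  let ?A = "(W \<rightarrow>\<^sub>E {..<k}) \<times> (P \<rightarrow>\<^sub>E {..<?p})"
  have finP: "finite P" and cardP: "card P = (\<Sum>b<k. b)" by (simp_all add: P_def)
  have sub: "F \<rightarrow>\<^sub>E {..<?p} \<subseteq> \<Phi> ` ?A"
  proof
    fix c assume c: "c \<in> F \<rightarrow>\<^sub>E {..<?p}"
    \<comment> \<open>The graph must have all of \<open>S\<close> as underlying graph, so edges not
      inside \<open>W\<close>, where \<open>c\<close> is \<open>undefined\<close>, get the legal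
      colour 0.\<close>
    define c' where "c' e = (if e \<in> F then c e else 0)" for e
    define col where "col u v = (if u = s {u, v} then c' {u, v} else flip n (c' {u, v}))" for u v
    have c'_less: "c' e < ?p" for e using c p by (auto simp: c'_def)
    have col_less: "col u v < ?p" for u v using c'_less flip_less by (simp add: col_def)
    have col_swap: "col v u = flip n (col u v)" if "{u, v} \<in> snd S" for u v
    proof -
      have "s {u, v} = u \<and> t {u, v} = v \<or> s {u, v} = v \<and> t {u, v} = u" "u \<noteq> v"
        using st[OF that] by (auto simp: doubleton_eq_iff)
      then show ?thesis by (auto simp: col_def insert_commute)
    qed
    let ?G = "coloured n S col"
    have G: "is_nm_graph n m ?G" "und ?G = S"
      and joined_G: "\<And>u v. {u, v} \<in> snd S \<Longrightarrow> joined n ?G (col u v) u v"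
      by (rule is_nm_graph_coloured und_coloured joined_coloured; use S col_less col_swap in blast)+
    obtain H :: "nat nm_graph" and \<phi>
      where H: "is_nm_graph n m H" "card (verts H) = chi_nm n m ?G" "nm_hom ?G H \<phi>"
      using chi_nm_witness[OF G(1)] by blast
    have cardH: "card (verts H) \<le> k" using chi_nm_le_simple[OF G(1)] H(2) G(2) k by simp
    obtain g where "bij_betw g (verts H) {0..<card (verts H)}"
      using ex_bij_betw_finite_nat[OF is_nm_graph.finite_verts[OF H(1)]] by blast
    then have inj: "inj_on g (verts H)" and "g ` verts H = {0..<card (verts H)}"
      by (simp_all add: bij_betw_def)
    then have g: "g x < k" if "x \<in> verts H" for x
      using cardH imageI[OF that, of g] by simp
    define g' where "g' = inv_into (verts H) g"
    have g'g: "g' (g x) = x" if "x \<in> verts H" for x using inj that by (simp add: g'_def)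
    \<comment> \<open>The colour table of \<open>H\<close> on renumbered vertices. Unjoined pairs
      get 0, which keeps all values below \<open>?p\<close>.\<close>
    define D where "D a b = (if \<exists>x<?p. joined n H x (g' a) (g' b)
        then SOME x. x < ?p \<and> joined n H x (g' a) (g' b) else 0)" for a b
    have D_less: "D a b < ?p" for a b
    proof (cases "\<exists>x<?p. joined n H x (g' a) (g' b)")
      case True
      from someI_ex[OF this] show ?thesis using True by (simp add: D_def)
    next
      case False
      show ?thesis unfolding D_def if_not_P[OF False] using p by linarith
    qed
    have D: "D (g u) (g v) = x" if "x < ?p" "joined n H x u v" for u v x
    proof -
      have uv: "u \<in> verts H" "v \<in> verts H" using is_nm_graph.joined_ends[OF H(1) that(2)] by blast+
      have ex: "\<exists>x. x < ?p \<and> joined n H x (g' (g u)) (g' (g v))" using that uv g'g by auto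
      from someI_ex[OF this] have "joined n H (D (g u) (g v)) u v"
        using ex uv g'g by (simp add: D_def)
      then show ?thesis using is_nm_graph.joined_unique[OF H(1)] that(2) by blast
    qed
    define f where "f = restrict (g \<circ> \<phi>) W"
    define h where "h = restrict (\<lambda>(a, b). D a b) P"
    have \<phi>: "\<phi> x \<in> verts H" if "x \<in> W" for x
      using H(3) W that unfolding nm_hom_def by (auto simp: coloured_def)
    have f: "f \<in> W \<rightarrow>\<^sub>E {..<k}" using g \<phi> by (auto simp: f_def)
    have h: "h \<in> P \<rightarrow>\<^sub>E {..<?p}" using D_less by (auto simp: h_def)
    have "(if f (t e) < f (s e) then h (f (s e), f (t e)) else flip n (h (f (t e), f (s e)))) = c e"
      if e: "e \<in> F" for e
    proof -
      let ?u = "s e" and ?v = "t e"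
      have eS: "e \<in> snd S" and uv: "{?u, ?v} = e" using e st by (auto simp: F_def)
      have uvW: "?u \<in> W" "?v \<in> W" using e uv by (auto simp: F_def)
      have "col ?u ?v = c e" using e uv by (simp add: col_def c'_def)
      then have "joined n ?G (c e) ?u ?v" using joined_G[of ?u ?v] eS uv by simp
      then have j: "joined n H (c e) (\<phi> ?u) (\<phi> ?v)" by (rule joined_hom[OF H(3)])
      then have j': "joined n H (flip n (c e)) (\<phi> ?v) (\<phi> ?u)" by (simp add: joined_flip)
      have ce: "c e < ?p" using c e by auto
      \<comment> \<open>The target has no loops, so one order of the two images is a pair in
        \<open>P\<close> and the decoder's second branch never meets equal images.\<close>
      have "\<phi> ?u \<noteq> \<phi> ?v" using is_nm_graph.joined_ends(3)[OF H(1) j] .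
      then have "g (\<phi> ?u) \<noteq> g (\<phi> ?v)" using inj \<phi> uvW by (simp add: inj_on_eq_iff)
      then show ?thesis
        using D[OF ce j] D[OF flip_less[OF ce] j'] g \<phi> uvW by (auto simp: f_def h_def P_def)
    qed
    then have "\<Phi> (f, h) = c" using c by (auto simp: \<Phi>_def fun_eq_iff PiE_def extensional_def restrict_def)
    then show "c \<in> \<Phi> ` ?A" using f h by blast
  qed
  have fin: "finite ?A" using finW finP by (simp add: finite_PiE)
  have "?p ^ card F = card (F \<rightarrow>\<^sub>E {..<?p})" using finF by (simp add: card_PiE)
  also have "\<dots> \<le> card (\<Phi> ` ?A)" using sub fin by (intro card_mono) auto
  also have "\<dots> \<le> card ?A" using fin by (rule card_image_le)
  also have "\<dots> = k ^ card W * ?p ^ card P" using finW finP by (simp add: card_cartesian_product card_PiE)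
  finally show ?thesis by (simp add: F_def cardP)
qed

section \<open>The bound on the arboricity\<close>

lemma card_edges_within_le:
  assumes "simple_graph S" "finite W"
  shows "card {e \<in> snd S. e \<subseteq> W} \<le> card W choose 2"
proof -
  have "{e \<in> snd S. e \<subseteq> W} \<subseteq> {e. e \<subseteq> W \<and> card e = 2}"
    using assms(1) unfolding simple_graph_def by auto
  moreover have "finite {e. e \<subseteq> W \<and> card e = 2}" using assms(2) by simp
  ultimately have "card {e \<in> snd S. e \<subseteq> W} \<le> card {e. e \<subseteq> W \<and> card e = 2}" by (rule card_mono[rotated])
  then show ?thesis by (simp add: n_subsets[OF assms(2)])
qed

text \<open>From 4 on, the increment \<open>2 * k + 1\<close> is at most \<open>k * k\<close>, so
  doubling keeps up; only \<open>9 > 8\<close> fails.\<close>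

lemma square_le_two_power:
  assumes "k \<noteq> 3"
  shows "k\<^sup>2 \<le> (2::nat) ^ k"
proof (cases "4 \<le> k")
  case True
  then show ?thesis
  proof (induction k rule: dec_induct)
    case (step k)
    then have "4 * k \<le> k * k" by simp
    moreover have "4 \<le> k" "k * k \<le> 2 ^ k" using step by (simp_all add: power2_eq_square)
    ultimately have "k * k + 2 * k + 1 \<le> 2 * 2 ^ k" by linarith
    then show ?case by (simp add: power2_eq_square)
  qed simp
next
  case False
  then have "k = 0 \<or> k = 1 \<or> k = 2" using assms by arith
  then show ?thesis by auto
qed

lemma log_le_half:
  fixes p k :: nat
  assumes "2 \<le> p" "1 \<le> k" "k \<noteq> 3"
  shows "log p k \<le> k / 2"
proof -
  have "k\<^sup>2 \<le> p ^ k"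
    using square_le_two_power[OF assms(3)] power_mono[OF assms(1), of k] by simp
  then have "(real k)\<^sup>2 \<le> real p ^ k" by (metis of_nat_le_iff of_nat_power)
  moreover have "0 < real k" "0 < real p" "log p p = 1" using assms by simp_all
  moreover from calculation have "log p ((real k)\<^sup>2) \<le> log p (real p ^ k)"
    using assms(1) by (subst log_le_cancel_iff) auto
  ultimately show ?thesis by (simp add: log_nat_power)
qed

text \<open>Rests on \<open>3 ^ 5 = 243\<close> and \<open>2 ^ 8 = 256\<close>.\<close>

lemma log_3_le:
  fixes p :: nat
  assumes "2 \<le> p"
  shows "log p 3 \<le> 8 / 5"
proof -
  have "2 ^ 8 \<le> real p ^ 8" using assms by (intro power_mono) auto
  then have "3 ^ 5 \<le> real p ^ 8" by simp
  then have "log p (3 ^ 5) \<le> log p (real p ^ 8)"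
    using assms by (subst log_le_cancel_iff) auto
  moreover have "log p (3 ^ 5) = 5 * log p 3" "log p (real p ^ 8) = 8"
    using assms log_nat_power[of 3 p 5] by (simp_all del: power_numeral)
  ultimately show ?thesis by linarith
qed

text \<open>
  Only for \<open>k = 3\<close> can \<open>log p k\<close> exceed \<open>k / 2\<close>; then the ceiling is at least 4, which suffices.
\<close>

lemma density_bound:
  fixes p k N q :: nat
  assumes p: "2 \<le> p" and N: "2 \<le> N" and q: "q \<le> N choose 2"
    and count: "p ^ q \<le> k ^ N * p ^ (\<Sum>b<k. b)"
  shows "q \<le> nat \<lceil>log p k + k / 2\<rceil> * (N - 1)"
proof -
  have k: "1 \<le> k"
  proof (rule ccontr)
    assume "\<not> 1 \<le> k"
    then have "k = 0" by simp
    then have "p ^ q \<le> 0" using count N by (simp add: power_0_left)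
    then show False using p by simp
  qed
  define L where "L = log p k"
  define r where "r = nat \<lceil>L + k / 2\<rceil>"
  define M where "M = real (N - 1)"
  have L0: "0 \<le> L" using k p by (simp add: L_def)
  have r: "L + k / 2 \<le> real r" unfolding r_def by linarith
  have sum_b: "real (\<Sum>b<k. b) = k * (real k - 1) / 2" for k
    by (induction k) (auto simp: field_simps)
  have M: "1 \<le> M" "real N = M + 1" using N by (simp_all add: M_def of_nat_diff)
  have "real q \<le> real r * M"
  proof (cases "N \<le> k")
    case True
    have "2 * q \<le> N * (N - 1)" using q by (simp add: choose_two)
    then have "2 * real q \<le> N * M" unfolding M_def by (metis of_nat_le_iff of_nat_mult of_nat_numeral)
    also have "\<dots> \<le> k * M" using True M by (intro mult_right_mono) auto
    finally have "real q \<le> (k / 2) * M" by simp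
    also have "\<dots> \<le> real r * M" using r L0 M by (intro mult_right_mono) auto
    finally show ?thesis .
  next
    case False
    then have kM: "k \<le> M" by (simp add: M_def)
    have "real p ^ q \<le> real k ^ N * real p ^ (\<Sum>b<k. b)"
      using count by (metis of_nat_le_iff of_nat_mult of_nat_power)
    then have "log p (real p ^ q) \<le> log p (real k ^ N * real p ^ (\<Sum>b<k. b))"
      using p k by (subst log_le_cancel_iff) auto
    also have "\<dots> = N * L + real (\<Sum>b<k. b)"
      using p k by (simp add: log_mult log_nat_power L_def del: of_nat_sum)
    finally have "real q \<le> N * L + real (\<Sum>b<k. b)"
      using p by (simp add: log_nat_power del: of_nat_sum)
    then have q_le: "real q \<le> (M + 1) * L + k * (real k - 1) / 2"
      unfolding sum_b M(2) .
    show ?thesis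
    proof (cases "L \<le> k / 2")
      case True
      \<comment> \<open>The extra \<open>L\<close> is absorbed by the term \<open>- k / 2\<close>;
        afterwards \<open>k \<le> M\<close> replaces one factor \<open>k\<close>.\<close>
      have "(M + 1) * L + k * (real k - 1) / 2 \<le> M * L + k / 2 * k"
        using True by (simp add: field_simps)
      also have "\<dots> \<le> M * L + k / 2 * M" using kM by (intro add_left_mono mult_left_mono) auto
      also have "\<dots> = (L + k / 2) * M" by (simp add: algebra_simps)
      also have "\<dots> \<le> real r * M" using r M by (intro mult_right_mono) auto
      finally show ?thesis using q_le by simp
    next
      case False
      then have k3: "k = 3" using log_le_half[OF p k] by (auto simp: L_def)
      then have L: "L \<le> 8 / 5" "3 / 2 < L" using log_3_le[OF p] False by (simp_all add: L_def)
      \<comment> \<open>The strict bound \<open>3 / 2 < L\<close> pushes the sum above 3, and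
        integrality then gives 4.\<close>
      then have "3 < real r" using r k3 by simp
      then have "4 \<le> real r" by simp
      have "real q \<le> (M + 1) * (8 / 5) + 3"
      proof -
        have "(M + 1) * L \<le> (M + 1) * (8 / 5)" using L(1) M by (intro mult_left_mono) auto
        moreover have "real q \<le> (M + 1) * L + 3" using q_le k3 by simp
        ultimately show ?thesis by linarith
      qed
      \<comment> \<open>Here \<open>M\<close> is at least 3.\<close>
      also have "\<dots> \<le> 4 * M" using kM k3 by (simp add: field_simps)
      also have "\<dots> \<le> real r * M" using \<open>4 \<le> real r\<close> M by (intro mult_right_mono) auto
      finally show ?thesis .
    qed
  qed
  then have "real q \<le> real (r * (N - 1))" by (simp add: M_def)
  then show ?thesis unfolding r_def L_def of_nat_le_iff .
qed

theorem theorem2p2: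
  fixes n m k :: nat and G :: "'a ugraph"
  assumes "2 * n + m \<ge> 1"
    and "(n, m) \<noteq> (0, 1)"
    and "simple_graph G"
    and "chi_nm_simple n m G = k"
  shows "int (arboricity G) \<le> \<lceil>log (real (2 * n + m)) (real k) + real k / 2\<rceil>"
proof -
  let ?p = "2 * n + m"
  have p: "2 \<le> ?p" using assms(1,2) by (cases n) auto
  let ?b = "\<lceil>log ?p k + k / 2\<rceil>"
  have "arboricity G \<le> nat ?b"
  proof (rule arboricity_le[OF assms(3)])
    fix W assume W: "W \<subseteq> fst G" "2 \<le> card W"
    then have "finite W" by (intro card_ge_0_finite) simp
    then show "card {e \<in> snd G. e \<subseteq> W} \<le> nat ?b * (card W - 1)"
      using density_bound[OF p W(2) card_edges_within_le[OF assms(3)]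
          count_edge_colourings[OF assms(1,3) W(1) assms(4)]] by blast
  qed
  moreover have "0 \<le> ?b"
  proof -
    \<comment> \<open>The graph without vertices has \<open>k = 0\<close>; there the logarithm takes
      its default value 0.\<close>
    have "0 \<le> log ?p k" using p by (cases "k = 0") (auto simp: log_def)
    then have "0 \<le> log ?p k + k / 2" by simp
    then show ?thesis by linarith
  qed
  ultimately show ?thesis by (simp only: le_nat_iff)
qed

end
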